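(* Let $k\ge 1$, $0\le\theta\le 1$, and $\theta_1,\dots,\theta_k\in[0,1]$ with $\sum_{i=1}^k\theta_i=1-\theta$. Let $\{Y_n\}$ be a stationary process satisfying $$Y_n=\begin{cases}\epsilon_n, & \text{with probability } \theta,\\ Y_{n-i}+\epsilon_n, & \text{with probability } \theta_i,\quad i=1,\dots,k,\end{cases}$$ where $\epsilon_n$ is independent of $\{Y_{n-1},Y_{n-2},\dots\}$. Then the Laplace transforms $\phi_Y$ of the marginals and $\phi_\epsilon$ of the innovation terms satisfy $$\phi_\epsilon(s)=\frac{\phi_Y(s)}{\theta+(1-\theta)\phi_Y(s)}.$$
   Context: The Laplace transform of a positive random variable $Z$ is $\phi_Z(s)=\mathbb{E}[e^{-sZ}]$, $s>0$; the variables $Y_n$ and $\epsilon_n$ are positive and the $\epsilon_n$ are identically distributed. The random choice among the $k+1$ alternatives at time $n$ is independent of $\epsilon_n$ and of the past of the process. *)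

theory Defs
  imports "HOL-Probability.Probability"
begin

definition laplace_transform :: "'a measure \<Rightarrow> ('a \<Rightarrow> real) \<Rightarrow> real \<Rightarrow> real" where
  "laplace_transform M Z s = (\<integral>\<omega>. exp (- s * Z \<omega>) \<partial>M)"

text \<open>Strict stationarity: the law of the whole two-sided path is invariant under time shifts.\<close>
definition stationary_process :: "'a measure \<Rightarrow> (int \<Rightarrow> 'a \<Rightarrow> real) \<Rightarrow> bool" where
  "stationary_process M Y \<longleftrightarrow>
     (\<forall>n. Y n \<in> borel_measurable M) \<and>
     (\<forall>h. distr M (\<Pi>\<^sub>M n\<in>UNIV. borel) (\<lambda>\<omega> n. Y (n + h) \<omega>)
        = distr M (\<Pi>\<^sub>M n\<in>UNIV. borel) (\<lambda>\<omega> n. Y n \<omega>))"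

definition past :: "(int \<Rightarrow> 'a \<Rightarrow> real) \<Rightarrow> int \<Rightarrow> 'a \<Rightarrow> int \<Rightarrow> real" where
  "past Y n \<omega> = (\<lambda>m\<in>{..<n}. Y m \<omega>)"

abbreviation past_space :: "int \<Rightarrow> (int \<Rightarrow> real) measure" where
  "past_space n \<equiv> (\<Pi>\<^sub>M m\<in>{..<n}. borel)"

text \<open>
  Independence of two random variables with values in possibly different types; the library's
  \<open>indep_var\<close> requires both variables to have the same value type.  The preimage families are
  the sigma-algebras generated by the variables.
\<close>
definition indep_rv ::
  "'a measure \<Rightarrow> 'b measure \<Rightarrow> ('a \<Rightarrow> 'b) \<Rightarrow> 'c measure \<Rightarrow> ('a \<Rightarrow> 'c) \<Rightarrow> bool" where
  "indep_rv M S X T Z \<longleftrightarrow>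
     X \<in> measurable M S \<and> Z \<in> measurable M T \<and>
     prob_space.indep_set M {X -` A \<inter> space M | A. A \<in> sets S} {Z -` B \<inter> space M | B. B \<in> sets T}"

text \<open>
  The random choice at time \<open>n\<close> is made explicit as a random variable \<open>J n\<close>: the value \<open>0\<close>
  selects the alternative \<open>\<epsilon> n\<close>, the value \<open>i \<in> {1..k}\<close> the alternative \<open>Y (n - i) + \<epsilon> n\<close>.
  That \<open>J n\<close> lies in \<open>{0..k}\<close> almost surely follows from the probabilities adding up to 1.
  The choice is independent of the innovation and the past of \<open>Y\<close> jointly.  Nothing is assumed
  about the dependence between the choices, or between the innovations, at different times.
\<close>
definition mixture_ar_process ::
  "'a measure \<Rightarrow> nat \<Rightarrow> real \<Rightarrow> (nat \<Rightarrow> real) \<Rightarrow> (int \<Rightarrow> 'a \<Rightarrow> real) \<Rightarrow> (int \<Rightarrow> 'a \<Rightarrow> real)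
     \<Rightarrow> (int \<Rightarrow> 'a \<Rightarrow> nat) \<Rightarrow> bool" where
  "mixture_ar_process M k \<theta> \<theta>s Y \<epsilon> J \<longleftrightarrow>
     (\<forall>n. Y n \<in> borel_measurable M \<and> \<epsilon> n \<in> borel_measurable M
        \<and> J n \<in> measurable M (count_space UNIV)) \<and>
     (\<forall>n. AE \<omega> in M. 0 < Y n \<omega> \<and> 0 < \<epsilon> n \<omega>) \<and>
     (\<forall>m n. distr M borel (\<epsilon> m) = distr M borel (\<epsilon> n)) \<and>
     (\<forall>n. measure M {\<omega> \<in> space M. J n \<omega> = 0} = \<theta>) \<and>
     (\<forall>n. \<forall>i\<in>{1..k}. measure M {\<omega> \<in> space M. J n \<omega> = i} = \<theta>s i) \<and>
     (\<forall>n. AE \<omega> in M. Y n \<omega> =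
        (if J n \<omega> = 0 then \<epsilon> n \<omega> else Y (n - int (J n \<omega>)) \<omega> + \<epsilon> n \<omega>)) \<and>
     (\<forall>n. indep_rv M borel (\<epsilon> n) (past_space n) (past Y n)) \<and>
     (\<forall>n. indep_rv M (count_space UNIV) (J n)
        (borel \<Otimes>\<^sub>M past_space n) (\<lambda>\<omega>. (\<epsilon> n \<omega>, past Y n \<omega>)))"

end

theory Submission imports Defs begin

text \<open>
  Split the expectation of \<open>exp (- s * Y n)\<close> according to the value of the choice \<open>J n\<close>.  By the two
  independence assumptions each piece factorises, so that with stationarity
  \<open>\<phi>\<^sub>Y = \<phi>\<^sub>\<epsilon> * (\<theta> + (1 - \<theta>) * \<phi>\<^sub>Y)\<close>; the second factor cannot vanish because \<open>\<phi>\<^sub>Y > 0\<close>.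
\<close>

lemma sigma_sets_vimage_comp_subset:
  assumes W: "W \<in> measurable M U" and h: "h \<in> measurable U N"
  shows "sigma_sets (space M) {(\<lambda>\<omega>. h (W \<omega>)) -` A \<inter> space M |A. A \<in> sets N}
      \<subseteq> {W -` A \<inter> space M |A. A \<in> sets U}"
proof -
  have sp: "W \<in> space M \<rightarrow> space U" using W by (rule measurable_space[THEN funcsetI])
  have eq: "{W -` A \<inter> space M |A. A \<in> sets U} = sets (vimage_algebra (space M) W U)"
    using sp by (simp add: sets_vimage_algebra2)
  have "{(\<lambda>\<omega>. h (W \<omega>)) -` A \<inter> space M |A. A \<in> sets N} \<subseteq> sets (vimage_algebra (space M) W U)"
  proof clarify
    fix A assume A: "A \<in> sets N"
    have "(\<lambda>\<omega>. h (W \<omega>)) -` A \<inter> space M = W -` (h -` A \<inter> space U) \<inter> space M"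
      using sp by auto
    then show "(\<lambda>\<omega>. h (W \<omega>)) -` A \<inter> space M \<in> sets (vimage_algebra (space M) W U)"
      unfolding eq[symmetric] using measurable_sets[OF h A] by blast
  qed
  from sets.sigma_sets_subset[OF this] show ?thesis unfolding eq by simp
qed

text \<open>Measurable functions of two independent variables generate smaller sigma-algebras, and
  independence passes to subfamilies. As \<open>f\<close> and \<open>g\<close> share a target type,
  this leads from \<open>indep_rv\<close> to \<open>indep_var\<close> and its product rule for
  expectations.\<close>

lemma (in prob_space) indep_rv_imp_indep_var:
  assumes ind: "indep_rv M S X T Z"
    and f: "f \<in> measurable S N" and g: "g \<in> measurable T L"
  shows "indep_var N (\<lambda>\<omega>. f (X \<omega>)) L (\<lambda>\<omega>. g (Z \<omega>))"
proof -
  have X: "X \<in> measurable M S" and Z: "Z \<in> measurable M T"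
    and I: "indep_set {X -` A \<inter> space M |A. A \<in> sets S} {Z -` B \<inter> space M |B. B \<in> sets T}"
    using ind by (auto simp: indep_rv_def)
  have "indep_set
      (sigma_sets (space M) {(\<lambda>\<omega>. f (X \<omega>)) -` A \<inter> space M |A. A \<in> sets N})
      (sigma_sets (space M) {(\<lambda>\<omega>. g (Z \<omega>)) -` A \<inter> space M |A. A \<in> sets L})"
    using I unfolding indep_set_def
  proof (rule indep_sets_mono_sets)
    show "case_bool
        (sigma_sets (space M) {(\<lambda>\<omega>. f (X \<omega>)) -` A \<inter> space M |A. A \<in> sets N})
        (sigma_sets (space M) {(\<lambda>\<omega>. g (Z \<omega>)) -` A \<inter> space M |A. A \<in> sets L}) b
      \<subseteq> case_bool {X -` A \<inter> space M |A. A \<in> sets S} {Z -` B \<inter> space M |B. B \<in> sets T} b" for b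
      using sigma_sets_vimage_comp_subset[OF X f] sigma_sets_vimage_comp_subset[OF Z g]
      by (cases b) simp_all
  qed
  then show ?thesis
    using measurable_compose[OF X f] measurable_compose[OF Z g] by (simp add: indep_var_eq)
qed

lemma (in prob_space) expectation_mult_indep_rv:
  fixes f :: "'b \<Rightarrow> real" and g :: "'c \<Rightarrow> real"
  assumes "indep_rv M S X T Z"
    and "f \<in> borel_measurable S" and "g \<in> borel_measurable T"
    and "integrable M (\<lambda>\<omega>. f (X \<omega>))" and "integrable M (\<lambda>\<omega>. g (Z \<omega>))"
  shows "expectation (\<lambda>\<omega>. f (X \<omega>) * g (Z \<omega>))
       = expectation (\<lambda>\<omega>. f (X \<omega>)) * expectation (\<lambda>\<omega>. g (Z \<omega>))"
  using indep_var_lebesgue_integral[OF indep_rv_imp_indep_var[OF assms(1-3)] assms(4,5)] .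

lemma (in prob_space) integrable_exp_nonpos:
  assumes "Z \<in> borel_measurable M" and "AE \<omega> in M. 0 \<le> Z \<omega>" and "0 \<le> (s::real)"
  shows "integrable M (\<lambda>\<omega>. exp (- s * Z \<omega>))"
proof (rule integrable_const_bound[where B = 1])
  show "AE \<omega> in M. norm (exp (- s * Z \<omega>)) \<le> 1"
    using assms(2) by eventually_elim (use assms(3) in auto)
qed (use assms(1) in measurable)

text \<open>The transform of \<open>Y h\<close> is the integral of a fixed function of coordinate 0
  against the law of the path shifted by \<open>h\<close>, and that law does not depend on
  \<open>h\<close>.\<close>

lemma stationary_process_laplace_transform:
  assumes "stationary_process M Y"
  shows "laplace_transform M (Y m) s = laplace_transform M (Y n) s"
proof -
  have Y[measurable]: "Y i \<in> borel_measurable M" for i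
    using assms by (simp add: stationary_process_def)
  have "laplace_transform M (Y h) s
      = (\<integral>p. exp (- s * p 0) \<partial>distr M (\<Pi>\<^sub>M n\<in>UNIV. borel) (\<lambda>\<omega> n. Y (n + h) \<omega>))" for h
    unfolding laplace_transform_def
    by (subst integral_distr) (auto intro!: measurable_PiM_single')
  also have "\<dots> h = (\<integral>p. exp (- s * p 0) \<partial>distr M (\<Pi>\<^sub>M n\<in>UNIV. borel) (\<lambda>\<omega> n. Y n \<omega>))" for h
    using assms by (simp add: stationary_process_def)
  finally show ?thesis by simp
qed

text \<open>The events \<open>J = i\<close> are disjoint, so the sum is the probability of their
  union \<open>J \<le> k\<close>.\<close>

lemma (in prob_space) AE_le_of_sum_prob_eq_1:
  fixes J :: "'a \<Rightarrow> nat"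
  assumes [measurable]: "J \<in> measurable M (count_space UNIV)"
    and "(\<Sum>i\<le>k. prob {\<omega> \<in> space M. J \<omega> = i}) = 1"
  shows "AE \<omega> in M. J \<omega> \<le> k"
proof -
  have "prob (\<Union>i\<le>k. {\<omega> \<in> space M. J \<omega> = i}) = (\<Sum>i\<le>k. prob {\<omega> \<in> space M. J \<omega> = i})"
    by (intro finite_measure_finite_Union) (auto simp: disjoint_family_on_def)
  also have "(\<Union>i\<le>k. {\<omega> \<in> space M. J \<omega> = i}) = {\<omega> \<in> space M. J \<omega> \<le> k}" by auto
  finally have "prob {\<omega> \<in> space M. J \<omega> \<le> k} = 1" using assms(2) by simp
  then show ?thesis by (simp add: prob_Collect_eq_1)
qed

theorem mainTheorem6:
  fixes M :: "'a measure"
    and k :: nat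
    and \<theta> :: real
    and \<theta>s :: "nat \<Rightarrow> real"
    and Y \<epsilon> :: "int \<Rightarrow> 'a \<Rightarrow> real"
    and J :: "int \<Rightarrow> 'a \<Rightarrow> nat"
  assumes "prob_space M"
    and "1 \<le> k"
    and "0 \<le> \<theta>" and "\<theta> \<le> 1"
    and "\<forall>i\<in>{1..k}. 0 \<le> \<theta>s i \<and> \<theta>s i \<le> 1"
    and "(\<Sum>i=1..k. \<theta>s i) = 1 - \<theta>"
    and "mixture_ar_process M k \<theta> \<theta>s Y \<epsilon> J"
    and "stationary_process M Y"
  shows "\<forall>s>0. \<forall>m n. laplace_transform M (\<epsilon> n) s =
           laplace_transform M (Y m) s / (\<theta> + (1 - \<theta>) * laplace_transform M (Y m) s)"
proof (intro allI impI)
  fix s :: real and m n :: int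
  assume s: "0 < s"
  interpret prob_space M by fact
  have Ym[measurable]: "Y i \<in> borel_measurable M"
    and em[measurable]: "\<epsilon> i \<in> borel_measurable M"
    and Jm[measurable]: "J i \<in> measurable M (count_space UNIV)"
    and pos: "AE \<omega> in M. 0 < Y i \<omega> \<and> 0 < \<epsilon> i \<omega>"
    and rec: "AE \<omega> in M. Y i \<omega> =
        (if J i \<omega> = 0 then \<epsilon> i \<omega> else Y (i - int (J i \<omega>)) \<omega> + \<epsilon> i \<omega>)"
    and ind_e: "indep_rv M borel (\<epsilon> i) (past_space i) (past Y i)"
    and ind_J: "indep_rv M (count_space UNIV) (J i)
        (borel \<Otimes>\<^sub>M past_space i) (\<lambda>\<omega>. (\<epsilon> i \<omega>, past Y i \<omega>))"
    and prob_J0: "prob {\<omega> \<in> space M. J i \<omega> = 0} = \<theta>"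
    and prob_J: "\<And>j. j \<in> {1..k} \<Longrightarrow> prob {\<omega> \<in> space M. J i \<omega> = j} = \<theta>s j" for i
    using assms(7) by (simp_all add: mixture_ar_process_def)
  let ?pY = "laplace_transform M (Y m) s" and ?pe = "laplace_transform M (\<epsilon> n) s"
  have intY: "integrable M (\<lambda>\<omega>. exp (- s * Y i \<omega>))" for i
    by (rule integrable_exp_nonpos) (use pos[of i] s in auto)
  have inte: "integrable M (\<lambda>\<omega>. exp (- s * \<epsilon> n \<omega>))"
    by (rule integrable_exp_nonpos) (use pos[of n] s in auto)
  \<comment> \<open>Stationarity enters here: \<open>Y n\<close>, every lagged
    \<open>Y (n - j)\<close> and the arbitrary \<open>Y m\<close> share one transform.\<close>
  have EY: "expectation (\<lambda>\<omega>. exp (- s * Y i \<omega>)) = ?pY" for i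
    using stationary_process_laplace_transform[OF assms(8), of i s m]
    by (simp add: laplace_transform_def)
  \<comment> \<open>The weights of all \<open>k + 1\<close> alternatives in one function; the value
    of \<open>\<theta>s\<close> at 0 is unconstrained, so index 0 is set to
    \<open>\<theta>\<close>.\<close>
  define p where "p j = (if j = 0 then \<theta> else \<theta>s j)" for j
  have prob_p: "prob {\<omega> \<in> space M. J n \<omega> = j} = p j" if "j \<le> k" for j
    using that prob_J0[of n] prob_J[of j n] by (simp add: p_def)
  have sum_p: "(\<Sum>j\<le>k. p j * c j) = \<theta> * c 0 + (\<Sum>j=1..k. \<theta>s j * c j)" for c :: "nat \<Rightarrow> real"
    by (simp add: atMost_atLeast0 sum.atLeast_Suc_atMost p_def)
  \<comment> \<open>The factor that the past contributes to \<open>exp (- s * Y n)\<close> under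
    alternative \<open>j\<close>, as a function of the past path \<open>q\<close>. Alternative 0
    uses no past value, hence the constant 1; for \<open>j > 0\<close> the index
    \<open>n - j\<close> lies below \<open>n\<close>, so it is a coordinate of
    \<open>past_space n\<close>.\<close>
  define h where "h j q = (if j = 0 then 1 else exp (- s * q (n - int j)))" for j and q :: "int \<Rightarrow> real"
  have hm[measurable]: "h j \<in> borel_measurable (past_space n)" for j
  proof (cases "j = 0")
    case False
    then have "n - int j \<in> {..<n}" by simp
    note [measurable] = measurable_component_singleton[OF this, of "\<lambda>_. borel"]
    show ?thesis using False by (simp add: h_def[abs_def])
  qed (simp add: h_def[abs_def])
  have h_past: "h j (past Y n \<omega>) = (if j = 0 then 1 else exp (- s * Y (n - int j) \<omega>))" for j \<omega>
    by (simp add: h_def past_def)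
  have int_h: "integrable M (\<lambda>\<omega>. h j (past Y n \<omega>))" for j
    using intY by (cases "j = 0") (simp_all add: h_past)
  have Eh: "expectation (\<lambda>\<omega>. h j (past Y n \<omega>)) = (if j = 0 then 1 else ?pY)" for j
    using EY by (cases "j = 0") (simp_all add: h_past prob_space)
  \<comment> \<open>The value of \<open>exp (- s * Y n)\<close> when the choice is \<open>j\<close>:
    an innovation factor times a past factor, which are independent by \<open>ind_e\<close>.\<close>
  let ?G = "\<lambda>j \<omega>. exp (- s * \<epsilon> n \<omega>) * h j (past Y n \<omega>)"
  have int_G: "integrable M (?G j)" for j
    by (rule indep_var_integrable[OF indep_rv_imp_indep_var[OF ind_e]])
      (use inte int_h in auto)
  have exp_m: "(\<lambda>e. exp (- s * e)) \<in> borel_measurable borel"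
    by measurable
  have EG: "expectation (?G j) = ?pe * (if j = 0 then 1 else ?pY)" for j
    using expectation_mult_indep_rv[OF ind_e[of n] exp_m hm[of j], OF inte int_h] Eh[of j]
    by (simp add: laplace_transform_def)
  let ?I = "\<lambda>j \<omega>. indicat_real {j} (J n \<omega>)"
  have int_I: "integrable M (?I j)" for j
    by (rule integrable_const_bound[where B = 1]) (auto simp: indicator_def)
  have EI: "expectation (?I j) = p j" if "j \<le> k" for j
  proof -
    have "expectation (?I j) = expectation (indicat_real {\<omega> \<in> space M. J n \<omega> = j})"
      by (rule Bochner_Integration.integral_cong) (auto simp: indicator_def)
    then show ?thesis using prob_p[OF that] by simp
  qed
  \<comment> \<open>\<open>ind_J\<close> separates the choice from the pair of innovation and past,
    so \<open>?G j\<close> has to be exhibited as a measurable function of that pair.\<close>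
  have Gm: "(\<lambda>(e, q). exp (- s * e) * h j q) \<in> borel_measurable (borel \<Otimes>\<^sub>M past_space n)" for j
    by measurable
  have int_IG: "integrable M (\<lambda>\<omega>. ?I j \<omega> * ?G j \<omega>)" for j
    using indep_var_integrable[OF indep_rv_imp_indep_var[OF ind_J _ Gm[of j], where f = "indicat_real {j}"]]
      int_I int_G by simp
  have EIG: "expectation (\<lambda>\<omega>. ?I j \<omega> * ?G j \<omega>) = p j * (?pe * (if j = 0 then 1 else ?pY))"
    if "j \<le> k" for j
    using expectation_mult_indep_rv[OF ind_J _ Gm[of j], where f = "indicat_real {j}"] int_I int_G EG EI[OF that]
    by simp
  \<comment> \<open>The weights add up to 1, so the finite sum over \<open>j \<le> k\<close> loses
    no mass.\<close>
  have "AE \<omega> in M. J n \<omega> \<le> k"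
    using sum_p[of "\<lambda>_. 1"] assms(6) prob_p by (intro AE_le_of_sum_prob_eq_1) auto
  then have "AE \<omega> in M. exp (- s * Y n \<omega>) = (\<Sum>j\<le>k. ?I j \<omega> * ?G j \<omega>)"
    using rec[of n]
  proof eventually_elim
    case (elim \<omega>)
    \<comment> \<open>The indicators keep only the summand of the alternative actually chosen, which
      the recursion identifies with \<open>exp (- s * Y n)\<close>.\<close>
    have "(\<Sum>j\<le>k. ?I j \<omega> * ?G j \<omega>) = (\<Sum>j\<le>k. if j = J n \<omega> then ?G j \<omega> else 0)"
      by (intro sum.cong) (auto simp: indicator_def)
    also have "\<dots> = ?G (J n \<omega>) \<omega>" using elim(1) by simp
    also have "\<dots> = exp (- s * Y n \<omega>)"
      by (subst elim(2)) (simp add: h_past flip: exp_add, simp add: algebra_simps)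
    finally show ?case by simp
  qed
  then have "?pY = expectation (\<lambda>\<omega>. \<Sum>j\<le>k. ?I j \<omega> * ?G j \<omega>)"
    unfolding EY[of n, symmetric]
    by (intro integral_cong_AE borel_measurable_sum borel_measurable_integrable int_IG intY)
  also have "\<dots> = (\<Sum>j\<le>k. p j * (?pe * (if j = 0 then 1 else ?pY)))"
    using int_IG EIG by (subst Bochner_Integration.integral_sum) auto
  also have "\<dots> = \<theta> * ?pe + (\<Sum>j=1..k. \<theta>s j) * (?pe * ?pY)"
    by (simp add: sum_p sum_distrib_right)
  finally have eq: "?pY = ?pe * (\<theta> + (1 - \<theta>) * ?pY)"
    unfolding assms(6) by (simp add: algebra_simps)
  have "0 < ?pY"
    unfolding laplace_transform_def using intY by (intro expectation_greater) auto
  \<comment> \<open>A vanishing denominator would turn \<open>eq\<close> into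
    \<open>?pY = 0\<close>.\<close>
  then have "\<theta> + (1 - \<theta>) * ?pY \<noteq> 0" using eq by auto
  then show "?pe = ?pY / (\<theta> + (1 - \<theta>) * ?pY)" using eq by (simp add: eq_divide_eq)
qed

end
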